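(* Let $0<q\le 1$, $0\le\theta\le1$, and let $k\ge1$ be an integer. For an integer $n\ge 0$ and an integer $x$ write $f_q(x;n,k;\theta)=P_{q,\theta}(E_{n,k}=x)$. Then for all integers $n\ge k$ and all $x\in\{0,1,\dots,\lfloor\frac{n+1}{k+1}\rfloor\}$, $$\begin{aligned}f_q(x;n,k;\theta)=&\sum_{\substack{i=1\\ i\ne k+1}}^{n}\theta^{i-1}(1-\theta)f_q(x;n-i,k;\theta q)+\theta^{k}(1-\theta)f_q(x-1;n-k-1,k;\theta q)\\&+\theta^{k}\delta_{x,1}\delta_{n,k}+\theta^{n}\delta_{x,0}I(n>k),\end{aligned}$$ where, for $n\ge 0$, $f_q(x;n,k;\theta)=0$ if $x<0$ or $x>\lfloor\frac{n+1}{k+1}\rfloor$, and $f_q(x;n,k;\theta)=\delta_{x,0}$ if $0\le n<k$; the term involving $f_q(x-1;n-k-1,k;\theta q)$ is taken to be $0$ when $n=k$.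
   Context: A $q$-sequence of binary trials with parameters $(\theta,q)$ is a sequence of $\{0,1\}$-valued random variables $X_1,X_2,\dots$ ($1$ = success, $0$ = failure) such that, conditionally on $X_1,\dots,X_{j-1}$, the probability that $X_j=1$ is $\theta q^{z}$, where $z=\sum_{m=1}^{j-1}(1-X_m)$ is the number of failures among the first $j-1$ trials (so the probability that $X_j=0$ is $1-\theta q^{z}$). For $q=1$ these are i.i.d. Bernoulli trials with success probability $\theta$. $P_{q,\theta}$ denotes probability under this model. A success run of length exactly $k$ is a block of $k$ consecutive ones that is preceded by a zero or by the beginning of the sequence and followed by a zero or by the end of the sequence. $E_{n,k}$ counts the success runs of length exactly $k$ in $X_1,\dots,X_n$; $E_{0,k}=0$. $\delta_{a,b}$ is the Kronecker delta, $I(\cdot)$ is the indicator of a condition ($1$ if true, $0$ if false), and $0^0=1$. *)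

theory Defs
  imports "HOL-Probability.Probability"
begin

definition failures_before :: "(nat \<Rightarrow> nat) \<Rightarrow> nat \<Rightarrow> nat" where
  "failures_before b j = (\<Sum>m\<in>{1..<j}. 1 - b m)"

text \<open>
  The trials are \<open>X 1, X 2, \<dots>\<close>; the component \<open>X 0\<close> plays no role.
  Conditioning on \<open>X 1, \<dots>, X (j - 1)\<close> is elementary: \<open>b\<close> ranges over the
  histories that occur with positive probability (so that \<open>b m \<in> {0, 1}\<close> there).
\<close>

definition q_sequence :: "'a measure \<Rightarrow> (nat \<Rightarrow> 'a \<Rightarrow> nat) \<Rightarrow> real \<Rightarrow> real \<Rightarrow> bool" where
  "q_sequence M X \<theta> q \<longleftrightarrow>
     prob_space M \<and>
     (\<forall>j\<ge>1. X j \<in> measurable M (count_space {0, 1})) \<and>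
     (\<forall>j\<ge>1. \<forall>b.
        \<P>(\<omega> in M. \<forall>m\<in>{1..<j}. X m \<omega> = b m) > 0 \<longrightarrow>
        \<P>(\<omega> in M. X j \<omega> = 1 \<bar> \<forall>m\<in>{1..<j}. X m \<omega> = b m) = \<theta> * q ^ failures_before b j)"

text \<open>Each run is identified with the position \<open>s\<close> of its first success.\<close>

definition exact_runs :: "nat \<Rightarrow> nat \<Rightarrow> (nat \<Rightarrow> nat) \<Rightarrow> nat" where
  "exact_runs n k b = card {s. 1 \<le> s \<and> s + k \<le> n + 1 \<and>
     (\<forall>m\<in>{s..<s + k}. b m = 1) \<and>
     (s = 1 \<or> b (s - 1) = 0) \<and>
     (s + k = n + 1 \<or> b (s + k) = 0)}"

definition run_prob :: "'a measure \<Rightarrow> (nat \<Rightarrow> 'a \<Rightarrow> nat) \<Rightarrow> int \<Rightarrow> nat \<Rightarrow> nat \<Rightarrow> real" where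
  "run_prob M X x n k = \<P>(\<omega> in M. int (exact_runs n k (\<lambda>m. X m \<omega>)) = x)"

text \<open>
  A \<open>q\<close>-sequence exists for all admissible parameters, so quantifying over all of them
  is not vacuous: take independent coins \<open>\<omega> (j, z)\<close> with success probabilities
  \<open>\<theta> * q ^ z\<close>, and let trial \<open>j\<close> show the coin \<open>(j, z)\<close>, where \<open>z\<close> is the
  number of failures so far.
\<close>

primrec coin_failures :: "(nat \<times> nat \<Rightarrow> bool) \<Rightarrow> nat \<Rightarrow> nat" where
  "coin_failures \<omega> 0 = 0"
| "coin_failures \<omega> (Suc j) =
     coin_failures \<omega> j + (if \<omega> (Suc j, coin_failures \<omega> j) then 0 else 1)"

definition coin_trial :: "nat \<Rightarrow> (nat \<times> nat \<Rightarrow> bool) \<Rightarrow> nat" where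
  "coin_trial j \<omega> = (if \<omega> (j, coin_failures \<omega> (j - 1)) then 1 else 0)"

definition coin_space :: "real \<Rightarrow> real \<Rightarrow> (nat \<times> nat \<Rightarrow> bool) measure" where
  "coin_space \<theta> q = (\<Pi>\<^sub>M i\<in>UNIV. measure_pmf (bernoulli_pmf (\<theta> * q ^ snd i)))"

lemma coin_failures_eq: "coin_failures \<omega> j = failures_before (\<lambda>m. coin_trial m \<omega>) (Suc j)"
  by (induction j) (auto simp: failures_before_def coin_trial_def atLeastLessThanSuc)

lemma failures_before_cong:
  "(\<And>m. m \<in> {1..<j} \<Longrightarrow> b m = c m) \<Longrightarrow> failures_before b j = failures_before c j"
  unfolding failures_before_def by (rule sum.cong) auto

lemma coin_history_iff:
  assumes "\<forall>m\<in>{1..<Suc j}. b m \<in> {0, 1}"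
  shows "(\<forall>m\<in>{1..<Suc j}. coin_trial m \<omega> = b m) \<longleftrightarrow>
         (\<forall>m\<in>{1..<Suc j}. \<omega> (m, failures_before b m) = (b m = 1))"
  using assms
proof (induction j)
  case (Suc j)
  let ?H = "\<forall>m\<in>{1..<Suc j}. coin_trial m \<omega> = b m"
  have IH: "?H \<longleftrightarrow> (\<forall>m\<in>{1..<Suc j}. \<omega> (m, failures_before b m) = (b m = 1))"
    using Suc.prems by (intro Suc.IH) auto
  have bj: "b (Suc j) \<in> {0, 1}"
    using Suc.prems by auto
  have split: "(\<forall>m\<in>{1..<Suc (Suc j)}. Q m) \<longleftrightarrow> (\<forall>m\<in>{1..<Suc j}. Q m) \<and> Q (Suc j)" for Q
    by (auto simp: less_Suc_eq)
  have "(coin_trial (Suc j) \<omega> = b (Suc j)) =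
        (\<omega> (Suc j, failures_before b (Suc j)) = (b (Suc j) = 1))" if ?H
  proof -
    have "coin_failures \<omega> j = failures_before b (Suc j)"
      unfolding coin_failures_eq using that by (intro failures_before_cong) auto
    then show ?thesis using bj by (auto simp: coin_trial_def)
  qed
  then show ?case
    unfolding split IH[symmetric] by blast
qed simp

lemma prob_coin_history:
  assumes "0 \<le> q" "q \<le> 1" "0 \<le> \<theta>" "\<theta> \<le> 1" and b: "\<forall>m\<in>{1..<Suc j}. b m \<in> {0, 1}"
  shows "\<P>(\<omega> in coin_space \<theta> q. \<forall>m\<in>{1..<Suc j}. coin_trial m \<omega> = b m) =
    (\<Prod>m\<in>{1..<Suc j}. if b m = 1 then \<theta> * q ^ failures_before b m
                        else 1 - \<theta> * q ^ failures_before b m)"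
proof -
  let ?K = "\<lambda>i::nat \<times> nat. measure_pmf (bernoulli_pmf (\<theta> * q ^ snd i))"
  let ?g = "\<lambda>m. (m, failures_before b m)"
  let ?E = "\<lambda>i::nat \<times> nat. {b (fst i) = 1}"
  interpret product_prob_space ?K UNIV
    by unfold_locales
  have p: "0 \<le> \<theta> * q ^ z" "\<theta> * q ^ z \<le> 1" for z
    using assms by (auto intro!: mult_le_one power_le_one)
  have eq: "{\<omega> \<in> space (coin_space \<theta> q). \<forall>m\<in>{1..<Suc j}. coin_trial m \<omega> = b m} =
        prod_emb UNIV ?K (?g ` {1..<Suc j}) (Pi\<^sub>E (?g ` {1..<Suc j}) ?E)"
    unfolding coin_history_iff[OF b]
    by (auto simp: coin_space_def prod_emb_def space_PiM PiE_iff)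
  have "\<P>(\<omega> in coin_space \<theta> q. \<forall>m\<in>{1..<Suc j}. coin_trial m \<omega> = b m) =
        (\<Prod>i\<in>?g ` {1..<Suc j}. measure (?K i) (?E i))"
    unfolding eq unfolding coin_space_def by (subst measure_PiM_emb) auto
  also have "\<dots> = (\<Prod>m\<in>{1..<Suc j}. measure (?K (?g m)) (?E (?g m)))"
    by (subst prod.reindex) (auto simp: inj_on_def)
  also have "\<dots> = (\<Prod>m\<in>{1..<Suc j}. if b m = 1 then \<theta> * q ^ failures_before b m
                        else 1 - \<theta> * q ^ failures_before b m)"
    by (intro prod.cong) (auto simp: measure_pmf_single p)
  finally show ?thesis .
qed

lemma measurable_coin_failures [measurable]:
  "(\<lambda>\<omega>. coin_failures \<omega> j) \<in> measurable (coin_space \<theta> q) (count_space UNIV)"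
proof (induction j)
  case (Suc j)
  note [measurable] = Suc
  have [measurable]: "Measurable.pred (coin_space \<theta> q) (\<lambda>\<omega>. \<omega> i)" for i
    unfolding coin_space_def by (rule measurable_compose[OF measurable_component_singleton]) auto
  have [measurable]: "Measurable.pred (coin_space \<theta> q) (\<lambda>\<omega>. \<omega> (Suc j, coin_failures \<omega> j))"
    by (rule measurable_compose_countable[OF _ Suc]) measurable
  show ?case by simp
qed simp

lemma measurable_coin_trial [measurable]:
  "coin_trial j \<in> measurable (coin_space \<theta> q) (count_space {0, 1})"
proof -
  have [measurable]: "Measurable.pred (coin_space \<theta> q) (\<lambda>\<omega>. \<omega> i)" for i
    unfolding coin_space_def by (rule measurable_compose[OF measurable_component_singleton]) auto
  have pred: "Measurable.pred (coin_space \<theta> q) (\<lambda>\<omega>. \<omega> (j, coin_failures \<omega> (j - 1)))"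
    by (rule measurable_compose_countable[OF _ measurable_coin_failures]) measurable
  show ?thesis
    using pred unfolding coin_trial_def[abs_def] by (intro measurable_If) (auto simp: pred_def)
qed

lemma q_sequence_coin_trial:
  assumes "0 \<le> q" "q \<le> 1" "0 \<le> \<theta>" "\<theta> \<le> 1"
  shows "q_sequence (coin_space \<theta> q) coin_trial \<theta> q"
proof -
  let ?M = "coin_space \<theta> q"
  have ps: "prob_space ?M"
    unfolding coin_space_def by (intro prob_space_PiM measure_pmf.prob_space_axioms)
  have "\<P>(\<omega> in ?M. coin_trial j \<omega> = 1 \<bar> \<forall>m\<in>{1..<j}. coin_trial m \<omega> = b m) =
        \<theta> * q ^ failures_before b j"
    if j: "1 \<le> j" and pos: "\<P>(\<omega> in ?M. \<forall>m\<in>{1..<j}. coin_trial m \<omega> = b m) > 0" for j b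
  proof -
    obtain i where i: "j = Suc i" using j by (cases j) auto
    have "{\<omega> \<in> space ?M. \<forall>m\<in>{1..<j}. coin_trial m \<omega> = b m} \<noteq> {}"
      using pos by (metis less_irrefl measure_empty)
    then have b: "\<forall>m\<in>{1..<Suc i}. b m \<in> {0, 1}"
      unfolding i by (fastforce simp: coin_trial_def split: if_splits)
    let ?c = "b(Suc i := 1)"
    let ?w = "\<lambda>b m. if b m = (1::nat) then \<theta> * q ^ failures_before b m
                        else 1 - \<theta> * q ^ failures_before b m"
    have fb: "failures_before ?c m = failures_before b m" if "m \<le> Suc i" for m
      using that by (intro failures_before_cong) auto
    have "\<P>(\<omega> in ?M. coin_trial j \<omega> = 1 \<and> (\<forall>m\<in>{1..<j}. coin_trial m \<omega> = b m)) =
          \<P>(\<omega> in ?M. \<forall>m\<in>{1..<Suc (Suc i)}. coin_trial m \<omega> = ?c m)"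
      unfolding i by (intro arg_cong[where f = "measure ?M"]) (auto simp: less_Suc_eq)
    also have "\<dots> = (\<Prod>m\<in>{1..<Suc (Suc i)}. ?w ?c m)"
      using b by (intro prob_coin_history assms) (auto simp: less_Suc_eq)
    also have "\<dots> = (\<Prod>m\<in>{1..<Suc i}. ?w ?c m) * ?w ?c (Suc i)"
      by (simp add: prod.atLeastLessThan_Suc)
    also have "(\<Prod>m\<in>{1..<Suc i}. ?w ?c m) = (\<Prod>m\<in>{1..<Suc i}. ?w b m)"
      by (intro prod.cong) (auto simp: fb[simplified])
    also have "\<dots> = \<P>(\<omega> in ?M. \<forall>m\<in>{1..<j}. coin_trial m \<omega> = b m)"
      unfolding i by (intro prob_coin_history[symmetric] assms b)
    finally show ?thesis
      using pos by (simp add: cond_prob_def fb[simplified] i)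
  qed
  then show ?thesis
    unfolding q_sequence_def using ps measurable_coin_trial by blast
qed

end

theory Submission
  imports Defs
begin

text \<open>
  Split a 0/1 string of length \<open>n\<close> at its first failure, at position \<open>i\<close> say. The leading
  block of successes has weight \<open>\<theta> ^ (i - 1)\<close> and is an exact run iff \<open>i = k + 1\<close>; the failure
  has weight \<open>1 - \<theta>\<close>; the rest of the string is weighted like a \<open>q\<close>-sequence with
  parameter \<open>\<theta> * q\<close>. The string without failures accounts for the two Kronecker terms.
\<close>

section \<open>Exact runs\<close>

text \<open>The disjuncts \<open>s = 1\<close> and \<open>s + k = n + 1\<close> shield the boundary
  tests from positions 0 and n + 1.\<close>

lemma exact_runs_cong:
  assumes "\<And>m. 1 \<le> m \<Longrightarrow> m \<le> n \<Longrightarrow> b m = c m"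
  shows "exact_runs n k b = exact_runs n k c"
  unfolding exact_runs_def
proof (intro arg_cong[where f = card] Collect_cong conj_cong refl)
  fix s assume s: "1 \<le> s" "s + k \<le> n + 1"
  show "(\<forall>m\<in>{s..<s + k}. b m = 1) = (\<forall>m\<in>{s..<s + k}. c m = 1)"
    using s assms by (intro ball_cong) auto
  show "(s = 1 \<or> b (s - 1) = 0) = (s = 1 \<or> c (s - 1) = 0)"
    using s assms[of "s - 1"] by (cases "s = 1") auto
  show "(s + k = n + 1 \<or> b (s + k) = 0) = (s + k = n + 1 \<or> c (s + k) = 0)"
    using s assms[of "s + k"] by (cases "s + k = n + 1") auto
qed

lemma exact_runs_short: "n < k \<Longrightarrow> exact_runs n k b = 0"
  unfolding exact_runs_def by (simp add: card_eq_0_iff)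

text \<open>Distinct runs start at least \<open>k + 1\<close> apart, so \<open>(s - 1) div (k + 1)\<close> determines the run.\<close>

lemma exact_runs_le: "exact_runs n k b \<le> (n + 1) div (k + 1)"
proof (cases "n < k")
  case True
  then show ?thesis by (simp add: exact_runs_short)
next
  case False
  define S where "S = {s. 1 \<le> s \<and> s + k \<le> n + 1 \<and> (\<forall>m\<in>{s..<s + k}. b m = 1) \<and>
     (s = 1 \<or> b (s - 1) = 0) \<and> (s + k = n + 1 \<or> b (s + k) = 0)}"
  let ?h = "\<lambda>s. (s - 1) div (k + 1)"
  \<comment> \<open>Otherwise position t - 1 lies inside the run at s and holds a one, whereas a run
    starting at t > 1 needs a zero there.\<close>
  have gap: "s + k < t" if "s \<in> S" "t \<in> S" "s < t" for s t
  proof (rule ccontr)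
    assume "\<not> s + k < t"
    with that have "t - 1 \<in> {s..<s + k}" "t \<noteq> 1" by (auto simp: S_def)
    then have "b (t - 1) = 1" "b (t - 1) = 0" using that unfolding S_def by blast+
    then show False by simp
  qed
  have less: "?h s < ?h t" if "s \<in> S" "t \<in> S" "s < t" for s t
  proof -
    have "s - 1 + (k + 1) \<le> t - 1"
      using gap[OF that] that by (auto simp: S_def)
    then have "(s - 1 + (k + 1)) div (k + 1) \<le> ?h t" by (rule div_le_mono)
    then show ?thesis by (subst (asm) div_add_self2) auto
  qed
  have "inj_on ?h S"
    by (rule linorder_inj_onI) (use less in \<open>force+\<close>)
  moreover have "?h ` S \<subseteq> {..<(n + 1) div (k + 1)}"
  proof safe
    fix s assume "s \<in> S"
    then have "s - 1 + (k + 1) \<le> n + 1" by (auto simp: S_def)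
    then have "(s - 1 + (k + 1)) div (k + 1) \<le> (n + 1) div (k + 1)" by (rule div_le_mono)
    then show "?h s < (n + 1) div (k + 1)" by (subst (asm) div_add_self2) auto
  qed
  ultimately have "card S \<le> card {..<(n + 1) div (k + 1)}"
    by (intro card_inj_on_le) auto
  then show ?thesis by (simp add: exact_runs_def S_def)
qed

text \<open>Without zeros a run can be delimited only by the two ends of the string, so it must be
  the whole string.\<close>

lemma exact_runs_all_ones:
  assumes "1 \<le> k" and ones: "\<And>m. 1 \<le> m \<Longrightarrow> m \<le> n \<Longrightarrow> b m = 1"
  shows "exact_runs n k b = of_bool (n = k)"
proof -
  have "{s. 1 \<le> s \<and> s + k \<le> n + 1 \<and> (\<forall>m\<in>{s..<s + k}. b m = 1) \<and>
     (s = 1 \<or> b (s - 1) = 0) \<and> (s + k = n + 1 \<or> b (s + k) = 0)} = (if n = k then {1} else {})"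
    (is "?S = _")
  proof (cases "n = k")
    case True
    then show ?thesis using ones by auto
  next
    case False
    have "s \<notin> ?S" for s
    proof
      assume s: "s \<in> ?S"
      have "s = 1"
      proof (rule ccontr)
        assume "s \<noteq> 1"
        then have "1 \<le> s - 1" "s - 1 \<le> n" "b (s - 1) = 0" using s \<open>1 \<le> k\<close> by auto
        then show False using ones[of "s - 1"] by simp
      qed
      moreover have "s + k = n + 1" using s ones[of "s + k"] by (cases "s + k = n + 1") auto
      ultimately show False using False by simp
    qed
    then show ?thesis using False by auto
  qed
  then show ?thesis by (simp add: exact_runs_def)
qed

text \<open>A run starting at or before i must start at 1, since no zero precedes i. It cannot
  contain the zero at i, nor stop earlier with a one after it; hence it ends at i - 1 and i = k + 1.
  The runs starting after i are those of the suffix, shifted by i.\<close>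

lemma exact_runs_first_failure:
  assumes "1 \<le> k" "1 \<le> i" "i \<le> n"
    and ones: "\<And>m. 1 \<le> m \<Longrightarrow> m < i \<Longrightarrow> b m = 1" and zero: "b i = 0"
  shows "exact_runs n k b = exact_runs (n - i) k (\<lambda>m. b (i + m)) + of_bool (i = k + 1)"
proof -
  let ?R = "\<lambda>n b s. 1 \<le> s \<and> s + k \<le> n + 1 \<and> (\<forall>m\<in>{s..<s + k}. b m = 1) \<and>
     (s = 1 \<or> b (s - 1) = 0) \<and> (s + k = n + 1 \<or> b (s + k) = (0::nat))"
  let ?b = "\<lambda>m. b (i + m)"
  have early: "?R n b s \<longleftrightarrow> s = 1 \<and> i = k + 1" if "s \<le> i" for s
  proof
    assume R: "?R n b s"
    have "s = 1"
    proof (rule ccontr)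
      assume "s \<noteq> 1"
      then have "1 \<le> s - 1" "s - 1 < i" "b (s - 1) = 0" using R that by auto
      then show False using ones[of "s - 1"] by simp
    qed
    moreover have "\<not> i < s + k"
    proof
      assume "i < s + k"
      then have "i \<in> {s..<s + k}" using that by simp
      then have "b i = 1" using R by blast
      then show False using zero by simp
    qed
    moreover have "\<not> s + k < i"
    proof
      assume "s + k < i"
      then show False using R ones[of "s + k"] assms by auto
    qed
    ultimately show "s = 1 \<and> i = k + 1" by auto
  qed (use assms in auto)
  have late: "?R n b (i + s) \<longleftrightarrow> ?R (n - i) ?b s" if "1 \<le> s" for s
  proof -
    have "(\<forall>m\<in>{i + s..<i + s + k}. b m = 1) \<longleftrightarrow> (\<forall>m\<in>{s..<s + k}. ?b m = 1)"
    proof -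
      have shift: "{i + s..<i + s + k} = (+) i ` {s..<s + k}" by (simp add: ac_simps)
      show ?thesis unfolding shift by blast
    qed
    \<comment> \<open>For s = 1 the left side holds through \<open>b i = 0\<close>: the failure at i
      delimits a run just as the beginning of the suffix does.\<close>
    moreover have "(i + s = 1 \<or> b (i + s - 1) = 0) \<longleftrightarrow> (s = 1 \<or> ?b (s - 1) = 0)"
      using that assms by (cases "s = 1") auto
    moreover have "i + s + k \<le> n + 1 \<longleftrightarrow> s + k \<le> n - i + 1"
      "i + s + k = n + 1 \<longleftrightarrow> s + k = n - i + 1" using assms by auto
    ultimately show ?thesis using that by (simp add: add.assoc)
  qed
  have "{s. ?R n b s} = (+) i ` {s. ?R (n - i) ?b s} \<union> (if i = k + 1 then {1} else {})"
  proof (rule set_eqI)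
    fix s
    show "s \<in> {s. ?R n b s} \<longleftrightarrow>
      s \<in> (+) i ` {s. ?R (n - i) ?b s} \<union> (if i = k + 1 then {1} else {})"
    proof (cases "s \<le> i")
      case True
      then show ?thesis using early[OF True] by auto
    next
      case False
      then obtain t where t: "s = i + t" "1 \<le> t"
        by (metis add_diff_inverse_nat diff_is_0_eq less_one linorder_not_le nat_le_linear)
      have "s \<noteq> 1" using t \<open>1 \<le> i\<close> by auto
      then have "s \<in> (+) i ` {s. ?R (n - i) ?b s} \<union> (if i = k + 1 then {1} else {}) \<longleftrightarrow>
          s \<in> (+) i ` {s. ?R (n - i) ?b s}"
        by simp
      also have "\<dots> \<longleftrightarrow> ?R (n - i) ?b t"
      proof -
        have "inj ((+) i)" by simp
        from inj_image_mem_iff[OF this] show ?thesis unfolding t(1) by simp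
      qed
      finally show ?thesis using late[OF t(2)] t(1) by simp
    qed
  qed
  moreover have "(+) i ` {s. ?R (n - i) ?b s} \<inter> (if i = k + 1 then {1} else {}) = {}"
    using \<open>1 \<le> i\<close> by auto
  moreover have "finite {s. ?R (n - i) ?b s}"
    by (rule finite_subset[of _ "{..n - i + 1}"]) auto
  ultimately have "card {s. ?R n b s} = card {s. ?R (n - i) ?b s} + of_bool (i = k + 1)"
    by (simp add: card_Un_disjoint card_image)
  then show ?thesis unfolding exact_runs_def .
qed

section \<open>Weights of finite histories\<close>

text \<open>Positions of trials start at 1, list indices at 0.\<close>

definition bits :: "bool list \<Rightarrow> nat \<Rightarrow> nat" where
  "bits xs m = of_bool (xs ! (m - 1))"

text \<open>After a failure the success probabilities of the remaining trials are those of a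
  sequence started at \<open>\<theta> * q\<close>. Updating the parameter replaces a failure counter
  and matches the shape of the recurrence.\<close>

fun history_weight :: "real \<Rightarrow> real \<Rightarrow> bool list \<Rightarrow> real" where
  "history_weight \<theta> q [] = 1"
| "history_weight \<theta> q (True # xs) = \<theta> * history_weight \<theta> q xs"
| "history_weight \<theta> q (False # xs) = (1 - \<theta>) * history_weight (\<theta> * q) q xs"

text \<open>The weight is defined from the front, but conditioning on the past extends histories at
  the back. Each failure passed multiplies the parameter by q, which gives the factor of the last
  trial.\<close>

lemma history_weight_snoc:
  "history_weight \<theta> q (xs @ [y]) = history_weight \<theta> q xs *
     (if y then \<theta> * q ^ count_list xs False else 1 - \<theta> * q ^ count_list xs False)"
proof (induction \<theta> q xs rule: history_weight.induct)
  case (1 \<theta> q)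
  then show ?case by (cases y) auto
qed (auto simp: algebra_simps)

lemma bits_append: "1 \<le> m \<Longrightarrow> m \<le> length xs \<Longrightarrow> bits (xs @ ys) m = bits xs m"
  by (auto simp: bits_def nth_append)

lemma failures_before_bits:
  "failures_before (bits xs) (Suc (length xs)) = count_list xs False"
proof (induction xs rule: rev_induct)
  case (snoc y xs)
  have "failures_before (bits (xs @ [y])) (Suc (length (xs @ [y]))) =
      failures_before (bits (xs @ [y])) (Suc (length xs)) + (1 - bits (xs @ [y]) (Suc (length xs)))"
    by (simp add: failures_before_def)
  also have "failures_before (bits (xs @ [y])) (Suc (length xs)) =
      failures_before (bits xs) (Suc (length xs))"
    by (rule failures_before_cong) (simp add: bits_append)
  finally show ?case using snoc by (simp add: bits_def)
qed (simp add: failures_before_def)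

text \<open>A measure-free form of \<open>run_prob\<close>. It depends on the parameters alone, so
  sequences on unrelated probability spaces can be compared through it.\<close>

definition runs_weight :: "real \<Rightarrow> real \<Rightarrow> int \<Rightarrow> nat \<Rightarrow> nat \<Rightarrow> real" where
  "runs_weight \<theta> q x n k = (\<Sum>xs | length xs = n.
     history_weight \<theta> q xs * of_bool (int (exact_runs n k (bits xs)) = x))"

lemma finite_bool_lists [simp]: "finite {xs :: bool list. length xs = n}"
  using finite_lists_length_eq[of "UNIV :: bool set" n] by simp

lemma sum_bool_lists_Suc:
  "(\<Sum>xs | length xs = Suc n. g xs) =
     (\<Sum>xs | length xs = n. g (True # xs)) + (\<Sum>xs | length xs = n. g (False # xs))"
  for g :: "bool list \<Rightarrow> 'c::comm_monoid_add"
proof -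
  let ?L = "{xs :: bool list. length xs = n}"
  have "{xs :: bool list. length xs = Suc n} = (#) True ` ?L \<union> (#) False ` ?L"
    by (auto simp: length_Suc_conv image_iff)
  moreover have "(#) True ` ?L \<inter> (#) False ` ?L = {}" by auto
  ultimately show ?thesis
    by (simp add: sum.union_disjoint sum.reindex)
qed

text \<open>The function g is arbitrary so that the induction can absorb a leading success into
  it.\<close>

lemma sum_history_weight_first_failure:
  fixes g :: "bool list \<Rightarrow> real"
  shows "(\<Sum>xs | length xs = n. history_weight \<theta> q xs * g xs) =
    (\<Sum>i\<in>{1..n}. \<theta> ^ (i - 1) * (1 - \<theta>) *
       (\<Sum>ys | length ys = n - i. history_weight (\<theta> * q) q ys *
          g (replicate (i - 1) True @ False # ys)))
    + \<theta> ^ n * g (replicate n True)"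
proof (induction n arbitrary: g)
  case (Suc n)
  let ?S = "\<lambda>m g. \<Sum>ys | length ys = m. history_weight (\<theta> * q) q ys * (g ys :: real)"
  have "(\<Sum>xs | length xs = Suc n. history_weight \<theta> q xs * g xs) =
      \<theta> * (\<Sum>xs | length xs = n. history_weight \<theta> q xs * g (True # xs)) +
      (1 - \<theta>) * ?S n (\<lambda>ys. g (False # ys))"
    by (simp add: sum_bool_lists_Suc sum_distrib_left mult.assoc)
  also have "\<dots> = (1 - \<theta>) * ?S n (\<lambda>ys. g (False # ys)) +
      (\<Sum>i\<in>{1..n}. \<theta> ^ i * (1 - \<theta>) * ?S (n - i) (\<lambda>ys. g (replicate i True @ False # ys)))
      + \<theta> ^ Suc n * g (replicate (Suc n) True)"
  proof -
    \<comment> \<open>Prepending a success moves the first failure from i to i + 1; from here to the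
      reindexing, i counts the leading successes.\<close>
    have "\<theta> * (\<theta> ^ (i - 1) * (1 - \<theta>) * ?S (n - i) (\<lambda>ys. g (True # replicate (i - 1) True @ False # ys))) =
       \<theta> ^ i * (1 - \<theta>) * ?S (n - i) (\<lambda>ys. g (replicate i True @ False # ys))"
      if "i \<in> {1..n}" for i
      using that by (cases i) auto
    then show ?thesis
      by (subst Suc.IH) (simp add: sum_distrib_left distrib_left)
  qed
  \<comment> \<open>The strings that begin with a failure form the missing term i = 0.\<close>
  also have "\<dots> = (\<Sum>i\<in>{0..n}. \<theta> ^ i * (1 - \<theta>) * ?S (n - i) (\<lambda>ys. g (replicate i True @ False # ys)))
      + \<theta> ^ Suc n * g (replicate (Suc n) True)"
    by (simp add: sum.atLeast_Suc_atMost)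
  also have "(\<Sum>i\<in>{0..n}. \<theta> ^ i * (1 - \<theta>) * ?S (n - i) (\<lambda>ys. g (replicate i True @ False # ys))) =
    (\<Sum>i\<in>{1..Suc n}. \<theta> ^ (i - 1) * (1 - \<theta>) *
       ?S (Suc n - i) (\<lambda>ys. g (replicate (i - 1) True @ False # ys)))"
    by (rule sum.reindex_bij_witness[of _ "\<lambda>i. i - 1" Suc]) auto
  finally show ?case .
qed simp

text \<open>Here g is the indicator of having x runs. If i = k + 1, the leading block is itself a
  run and the suffix must supply x - 1; as x is an integer, x = 0 leaves the unattainable count
  -1.\<close>

lemma runs_weight_first_failure:
  assumes "1 \<le> k"
  shows "runs_weight \<theta> q x n k =
    (\<Sum>i\<in>{1..n}. \<theta> ^ (i - 1) * (1 - \<theta>) *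
       runs_weight (\<theta> * q) q (x - of_bool (i = k + 1)) (n - i) k)
    + \<theta> ^ n * of_bool (x = of_bool (n = k))"
proof -
  have split: "exact_runs n k (bits (replicate (i - 1) True @ False # ys)) =
      exact_runs (n - i) k (bits ys) + of_bool (i = k + 1)"
    if "i \<in> {1..n}" "length ys = n - i" for i ys
  proof -
    let ?b = "bits (replicate (i - 1) True @ False # ys)"
    have "exact_runs n k ?b = exact_runs (n - i) k (\<lambda>m. ?b (i + m)) + of_bool (i = k + 1)"
      using that assms by (intro exact_runs_first_failure) (auto simp: bits_def nth_append)
    also have "exact_runs (n - i) k (\<lambda>m. ?b (i + m)) = exact_runs (n - i) k (bits ys)"
      using that by (intro exact_runs_cong) (auto simp: bits_def nth_append nth_Cons')
    finally show ?thesis .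
  qed
  have "(\<Sum>ys | length ys = n - i. history_weight (\<theta> * q) q ys *
      of_bool (int (exact_runs n k (bits (replicate (i - 1) True @ False # ys))) = x)) =
    runs_weight (\<theta> * q) q (x - of_bool (i = k + 1)) (n - i) k" if "i \<in> {1..n}" for i
    unfolding runs_weight_def
  proof (intro sum.cong refl arg_cong2[where f = "(*)"])
    fix ys :: "bool list" assume "ys \<in> {ys. length ys = n - i}"
    then have "int (exact_runs n k (bits (replicate (i - 1) True @ False # ys))) =
        int (exact_runs (n - i) k (bits ys)) + of_bool (i = k + 1)"
      by (subst split[OF that]) auto
    then show "of_bool (int (exact_runs n k (bits (replicate (i - 1) True @ False # ys))) = x) =
        (of_bool (int (exact_runs (n - i) k (bits ys)) = x - of_bool (i = k + 1)) :: real)"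
      by (simp only: eq_diff_eq)
  qed
  moreover have "int (exact_runs n k (bits (replicate n True))) = of_bool (n = k)"
    by (subst exact_runs_all_ones[OF assms]) (auto simp: bits_def)
  ultimately show ?thesis
    unfolding runs_weight_def[of \<theta> q x n k] sum_history_weight_first_failure[of \<theta> q _ n]
    by (simp only: eq_commute[of x] cong: sum.cong)
qed

section \<open>The law of a q-sequence\<close>

lemma q_sequence_values:
  assumes "q_sequence M X \<theta> q" "j \<ge> 1" "\<omega> \<in> space M"
  shows "X j \<omega> = 0 \<or> X j \<omega> = 1"
  using assms measurable_space[of "X j" M "count_space {0, 1}" \<omega>]
  by (auto simp: q_sequence_def)

lemma q_sequence_events:
  assumes "q_sequence M X \<theta> q" "j \<ge> 1"
  shows "{\<omega> \<in> space M. X j \<omega> = c} \<in> sets M"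
proof -
  have "X j \<in> measurable M (count_space {0, 1})"
    using assms by (simp add: q_sequence_def)
  \<comment> \<open>The value c may lie outside {0, 1}; intersecting gives a set of the count space
    with the same preimage in the space of M.\<close>
  then have "X j -` ({c} \<inter> {0, 1}) \<inter> space M \<in> sets M"
    by (rule measurable_sets) simp
  also have "X j -` ({c} \<inter> {0, 1}) \<inter> space M = {\<omega> \<in> space M. X j \<omega> = c}"
    using q_sequence_values[OF assms] by auto
  finally show ?thesis .
qed

text \<open>This is the chain rule, by induction on the last trial because \<open>q_sequence\<close>
  conditions on the past.\<close>

lemma q_sequence_history_prob:
  assumes "q_sequence M X \<theta> q"
  shows "\<P>(\<omega> in M. \<forall>m\<in>{1..<Suc (length xs)}. X m \<omega> = bits xs m) = history_weight \<theta> q xs"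
proof -
  interpret prob_space M
    using assms by (simp add: q_sequence_def)
  have hist_set: "{\<omega> \<in> space M. \<forall>m\<in>{1..<j}. X m \<omega> = b m} \<in> events" for j b
    by (intro sets.sets_Collect_finite_All) (auto intro: q_sequence_events[OF assms])
  show ?thesis
  proof (induction xs rule: rev_induct)
    case Nil
    then show ?case by (simp add: prob_space)
  next
    case (snoc y xs)
    let ?n = "Suc (length xs)"
    let ?H = "{\<omega> \<in> space M. \<forall>m\<in>{1..<?n}. X m \<omega> = bits xs m}"
    let ?p = "\<theta> * q ^ count_list xs False"
    let ?A = "\<lambda>c. {\<omega> \<in> space M. X ?n \<omega> = c \<and> (\<forall>m\<in>{1..<?n}. X m \<omega> = bits xs m)}"
    have A_eq: "?A c = {\<omega> \<in> space M. X ?n \<omega> = c} \<inter> ?H" for c by auto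
    have A: "?A c \<in> events" for c
      unfolding A_eq by (intro sets.Int q_sequence_events[OF assms] hist_set) simp
    \<comment> \<open>Only the success probability is prescribed; that of a failure follows by
      subtraction from the probability of the history.\<close>
    have "?H = ?A 1 \<union> ?A 0"
      using q_sequence_values[OF assms, of ?n] by fastforce
    then have total: "prob ?H = prob (?A 1) + prob (?A 0)"
      using A by (simp only:) (rule finite_measure_Union, auto)
    have one: "prob (?A 1) = prob ?H * ?p"
    proof (cases "prob ?H > 0")
      case True
      have "\<P>(\<omega> in M. X ?n \<omega> = 1 \<bar> \<forall>m\<in>{1..<?n}. X m \<omega> = bits xs m) = ?p"
        using assms True unfolding q_sequence_def failures_before_bits[symmetric] by simp
      then show ?thesis using True by (simp add: cond_prob_def field_simps)
    next
      \<comment> \<open>A null history has no prescribed conditional probability, but then both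
        sides vanish.\<close>
      case False
      then have "prob ?H = 0" using measure_nonneg[of M ?H] by linarith
      moreover have "prob (?A 1) \<le> prob ?H"
        unfolding A_eq by (intro finite_measure_mono hist_set) auto
      moreover have "prob (?A 1) \<ge> 0" by (rule measure_nonneg)
      ultimately have "prob (?A 1) = 0" by linarith
      then show ?thesis unfolding \<open>prob ?H = 0\<close> by simp
    qed
    have "{\<omega> \<in> space M. \<forall>m\<in>{1..<Suc (length (xs @ [y]))}. X m \<omega> = bits (xs @ [y]) m} =
        ?A (of_bool y)"
    proof -
      have "(\<forall>m\<in>{1..<Suc (length (xs @ [y]))}. Q m) \<longleftrightarrow> Q ?n \<and> (\<forall>m\<in>{1..<?n}. Q m)" for Q
        by (auto simp: less_Suc_eq)
      moreover have "bits (xs @ [y]) ?n = of_bool y" by (simp add: bits_def)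
      moreover have "bits (xs @ [y]) m = bits xs m" if "m \<in> {1..<?n}" for m
        using that by (simp add: bits_append)
      ultimately show ?thesis by (simp only: cong: ball_cong)
    qed
    then show ?case
      using snoc total one by (cases y) (simp_all add: history_weight_snoc algebra_simps)
  qed
qed

text \<open>The event is the disjoint union of the histories of length n having x exact runs, so its
  probability is the sum of their weights.\<close>

lemma run_prob_eq_runs_weight:
  assumes "q_sequence M X \<theta> q"
  shows "run_prob M X x n k = runs_weight \<theta> q x n k"
proof -
  interpret prob_space M
    using assms by (simp add: q_sequence_def)
  have X01: "X j \<omega> = 0 \<or> X j \<omega> = 1" if "j \<ge> 1" "\<omega> \<in> space M" for j \<omega>
    using q_sequence_values[OF assms that] .
  let ?H = "\<lambda>xs. {\<omega> \<in> space M. \<forall>m\<in>{1..<Suc n}. X m \<omega> = bits xs m}"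
  let ?L = "{xs. length xs = n \<and> int (exact_runs n k (bits xs)) = x}"
  have H: "?H xs \<in> events" for xs
    by (intro sets.sets_Collect_finite_All) (auto intro: q_sequence_events[OF assms])
  have runs: "exact_runs n k (\<lambda>m. X m \<omega>) = exact_runs n k (bits xs)" if "\<omega> \<in> ?H xs" for \<omega> xs
    using that by (intro exact_runs_cong) auto
  have "{\<omega> \<in> space M. int (exact_runs n k (\<lambda>m. X m \<omega>)) = x} = (\<Union>xs\<in>?L. ?H xs)"
  proof (intro equalityI subsetI)
    fix \<omega> assume \<omega>: "\<omega> \<in> {\<omega> \<in> space M. int (exact_runs n k (\<lambda>m. X m \<omega>)) = x}"
    \<comment> \<open>The witness is the observed history of the outcome; \<open>Suc\<close>
      converts list indices to trial positions.\<close>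
    let ?xs = "map (\<lambda>m. X (Suc m) \<omega> = 1) [0..<n]"
    have "X m \<omega> = bits ?xs m" if "m \<in> {1..<Suc n}" for m
      using that X01[of m \<omega>] \<omega> by (cases m) (auto simp: bits_def)
    then have "\<omega> \<in> ?H ?xs" using \<omega> by blast
    moreover from this have "?xs \<in> ?L" using runs[of \<omega> ?xs] \<omega> by simp
    ultimately show "\<omega> \<in> (\<Union>xs\<in>?L. ?H xs)" by (rule UN_I[rotated])
  next
    fix \<omega> assume "\<omega> \<in> (\<Union>xs\<in>?L. ?H xs)"
    then obtain xs where "xs \<in> ?L" "\<omega> \<in> ?H xs" by (rule UN_E)
    then show "\<omega> \<in> {\<omega> \<in> space M. int (exact_runs n k (\<lambda>m. X m \<omega>)) = x}"
      using runs[of \<omega> xs] by simp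
  qed
  moreover have "disjoint_family_on ?H ?L"
    unfolding disjoint_family_on_def
  proof (intro ballI impI equals0I)
    fix xs ys \<omega> assume L: "xs \<in> ?L" "ys \<in> ?L" "xs \<noteq> ys" and \<omega>: "\<omega> \<in> ?H xs \<inter> ?H ys"
    have "xs ! i = ys ! i" if "i < n" for i
    proof -
      have "bits xs (Suc i) = bits ys (Suc i)" using \<omega> that by fastforce
      then show ?thesis
        by (cases "xs ! i"; cases "ys ! i") (auto simp: bits_def)
    qed
    then show False using L by (auto simp: list_eq_iff_nth_eq)
  qed
  moreover have fin: "finite ?L"
    by (rule finite_subset[OF _ finite_bool_lists[of n]]) auto
  ultimately have "run_prob M X x n k = (\<Sum>xs\<in>?L. prob (?H xs))"
    using H by (simp only: run_prob_def) (rule finite_measure_finite_Union, auto)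
  also have "\<dots> = (\<Sum>xs\<in>?L. history_weight \<theta> q xs)"
    using q_sequence_history_prob[OF assms] by (intro sum.cong) auto
  also have "\<dots> = runs_weight \<theta> q x n k"
    unfolding runs_weight_def by (rule sum.mono_neutral_cong_left) auto
  finally show ?thesis .
qed

section \<open>Boundary values and the recurrence for \<open>run_prob\<close>\<close>

lemma run_prob_out_of_range:
  assumes "x < 0 \<or> x > int ((n + 1) div (k + 1))"
  shows "run_prob M X x n k = 0"
proof -
  have "int (exact_runs n k b) \<noteq> x" for b
    using assms exact_runs_le[of n k b] by linarith
  then show ?thesis by (simp add: run_prob_def)
qed

lemma run_prob_short:
  assumes "q_sequence M X \<theta> q" "n < k"
  shows "run_prob M X x n k = of_bool (x = 0)"
proof -
  interpret prob_space M
    using assms by (simp add: q_sequence_def)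
  show ?thesis using assms by (auto simp: run_prob_def exact_runs_short prob_space)
qed

theorem theorem3p2:
  fixes q \<theta> :: real and k :: nat
    and M :: "'a measure" and X :: "nat \<Rightarrow> 'a \<Rightarrow> nat"
    and M' :: "'b measure" and X' :: "nat \<Rightarrow> 'b \<Rightarrow> nat"
  assumes "0 < q" "q \<le> 1" "0 \<le> \<theta>" "\<theta> \<le> 1" "1 \<le> k"
    and "q_sequence M X \<theta> q"
    and "q_sequence M' X' (\<theta> * q) q"
  shows "let f = \<lambda>x n. run_prob M X x n k;
             f' = \<lambda>x n. run_prob M' X' x n k
    in (\<forall>n\<ge>k. \<forall>x\<in>{0..\<lfloor>(real n + 1) / (real k + 1)\<rfloor>}.
          f x n =
            (\<Sum>i\<in>{1..n} - {k + 1}. \<theta> ^ (i - 1) * (1 - \<theta>) * f' x (n - i))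
            + (if n = k then 0 else \<theta> ^ k * (1 - \<theta>) * f' (x - 1) (n - k - 1))
            + \<theta> ^ k * of_bool (x = 1) * of_bool (n = k)
            + \<theta> ^ n * of_bool (x = 0) * of_bool (n > k))
      \<and> (\<forall>n x. x < 0 \<or> x > \<lfloor>(real n + 1) / (real k + 1)\<rfloor> \<longrightarrow> f x n = 0 \<and> f' x n = 0)
      \<and> (\<forall>n<k. \<forall>x. f x n = of_bool (x = 0) \<and> f' x n = of_bool (x = 0))"
proof -
  have floor: "\<lfloor>(real n + 1) / (real k + 1)\<rfloor> = int ((n + 1) div (k + 1))" for n
    using floor_divide_of_nat_eq[of "n + 1" "k + 1", where 'a = real] by (simp add: add.commute)
  have rec: "run_prob M X x n k =
            (\<Sum>i\<in>{1..n} - {k + 1}. \<theta> ^ (i - 1) * (1 - \<theta>) * run_prob M' X' x (n - i) k)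
            + (if n = k then 0 else \<theta> ^ k * (1 - \<theta>) * run_prob M' X' (x - 1) (n - k - 1) k)
            + \<theta> ^ k * of_bool (x = 1) * of_bool (n = k)
            + \<theta> ^ n * of_bool (x = 0) * of_bool (n > k)" if "k \<le> n" for n x
  proof -
    let ?g = "\<lambda>i. \<theta> ^ (i - 1) * (1 - \<theta>) *
      runs_weight (\<theta> * q) q (x - of_bool (i = k + 1)) (n - i) k"
    \<comment> \<open>The index k + 1 belongs to the range exactly when n > k, whence the case
      distinction on n = k.\<close>
    have "(\<Sum>i\<in>{1..n}. ?g i) =
        (\<Sum>i\<in>{1..n} - {k + 1}. ?g i) + (if n = k then 0 else ?g (k + 1))"
      using that sum.remove[of "{1..n}" "k + 1" ?g] by (cases "n = k") auto
    also have "(\<Sum>i\<in>{1..n} - {k + 1}. ?g i) =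
        (\<Sum>i\<in>{1..n} - {k + 1}. \<theta> ^ (i - 1) * (1 - \<theta>) * runs_weight (\<theta> * q) q x (n - i) k)"
      by (intro sum.cong) auto
    \<comment> \<open>The all-success term requires x = 1 if n = k and x = 0 if n > k, so it splits
      into the two Kronecker terms.\<close>
    finally show ?thesis
      using that
      by (simp add: run_prob_eq_runs_weight[OF assms(6)] run_prob_eq_runs_weight[OF assms(7)]
          runs_weight_first_failure[OF assms(5), of \<theta> q x n])
  qed
  show ?thesis
    unfolding Let_def floor
    by (intro conjI allI ballI impI rec run_prob_out_of_range
        run_prob_short[OF assms(6)] run_prob_short[OF assms(7)])
qed

end
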